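(* Let $k\geq 1$ be an integer. For every signed permutation $(\sigma,\tau)$ of order $n$, the algorithm GREEDY (with $k$ slots per node) constructs an optimal heap decomposition of $(\sigma,\tau)$, i.e. a decomposition into heap-ordered $k$-ary trees using the minimum possible number of trees among all heap decompositions of $(\sigma,\tau)$. In particular GREEDY decides the heapability of $(\sigma,\tau)$: $(\sigma,\tau)$ is heapable if and only if GREEDY produces a single tree.
   Context: A signed permutation of order $n\ge 1$ is a pair $(\sigma,\tau)$ where $\sigma$ is a permutation of $[n]=\{1,\ldots,n\}$ and $\tau:[n]\to\{\pm1\}$ is a sign function. A heap decomposition of $(\sigma,\tau)$ (into $k$-ary trees) is a forest of rooted trees on the elements $\sigma(1),\ldots,\sigma(n)$, built by inserting the elements successively in the order $\sigma(1),\sigma(2),\ldots,\sigma(n)$, where each $\sigma(i)$ is inserted either as the root of a new tree or as a new leaf that is a child of an already inserted $\sigma(j)$, $j<i$, subject to: $\sigma(j)<\sigma(i)$, $\tau(i)=-\tau(j)$, and every node has at most $k$ children. The trees need not be complete. The size of the decomposition is its number of trees. $(\sigma,\tau)$ is heapable if it has a heap decomposition with exactly one tree. Algorithm GREEDY: start with the empty forest. For $i=1,\ldots,n$: each already inserted element $\sigma(j)$ offers $k$ slots, each of value $\sigma(j)$, minus those already occupied by children; a free slot of $\sigma(j)$ is compatible with $\sigma(i)$ if $\sigma(j)<\sigma(i)$ and $\tau(j)=-\tau(i)$. If a compatible free slot exists, insert $\sigma(i)$ in a compatible free slot of largest value (i.e. as a child of the corresponding $\sigma(j)$); otherwise start a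 new tree with root $\sigma(i)$. *)

theory Defs
  imports Main "HOL-Combinatorics.Permutations" "HOL-Library.FuncSet"
begin

definition signed_permutation :: "nat \<Rightarrow> (nat \<Rightarrow> nat) \<Rightarrow> (nat \<Rightarrow> int) \<Rightarrow> bool" where
  "signed_permutation n \<sigma> \<tau> \<longleftrightarrow> n \<ge> 1 \<and> \<sigma> permutes {1..n} \<and> \<tau> \<in> {1..n} \<rightarrow> {1, -1}"

text \<open>
  A forest of rooted trees is a partial map on elements: \<open>F x = None\<close> if \<open>x\<close> has not been
  inserted, \<open>F x = Some None\<close> if \<open>x\<close> is a root, and \<open>F x = Some (Some y)\<close> if \<open>x\<close> is a child
  of \<open>y\<close>. Nothing in the type excludes cycles; the forests used below are acyclic because they
  are built by adding leaves.
\<close>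

type_synonym forest = "nat \<rightharpoonup> nat option"

definition children :: "forest \<Rightarrow> nat \<Rightarrow> nat set" where
  "children F y = {x. F x = Some (Some y)}"

definition roots :: "forest \<Rightarrow> nat set" where
  "roots F = {x. F x = Some None}"

text \<open>A tree of the forest is given by its set of nodes: a root and all its descendants.\<close>

definition trees :: "forest \<Rightarrow> nat set set" where
  "trees F = {{x. (r, x) \<in> {(y, z). z \<in> children F y}\<^sup>*} | r. r \<in> roots F}"

definition forest_size :: "forest \<Rightarrow> nat" where
  "forest_size F = card (trees F)"

text \<open>
  \<open>heap_building \<sigma> \<tau> i F\<close>: the forest \<open>F\<close> can arise by inserting \<open>\<sigma> 1, \<dots>, \<sigma> i\<close> in this order,
  with the order and sign conditions but without a bound on the number of children.
\<close>

inductive heap_building :: "(nat \<Rightarrow> nat) \<Rightarrow> (nat \<Rightarrow> int) \<Rightarrow> nat \<Rightarrow> forest \<Rightarrow> bool"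
  for \<sigma> :: "nat \<Rightarrow> nat" and \<tau> :: "nat \<Rightarrow> int" where
  empty: "heap_building \<sigma> \<tau> 0 Map.empty"
| new_root: "heap_building \<sigma> \<tau> i F \<Longrightarrow> heap_building \<sigma> \<tau> (Suc i) (F(\<sigma> (Suc i) \<mapsto> None))"
| new_leaf: "heap_building \<sigma> \<tau> i F \<Longrightarrow> j \<in> {1..i} \<Longrightarrow> \<sigma> j < \<sigma> (Suc i) \<Longrightarrow> \<tau> (Suc i) = - \<tau> j
    \<Longrightarrow> heap_building \<sigma> \<tau> (Suc i) (F(\<sigma> (Suc i) \<mapsto> Some (\<sigma> j)))"

definition heap_decomposition ::
    "nat \<Rightarrow> nat \<Rightarrow> (nat \<Rightarrow> nat) \<Rightarrow> (nat \<Rightarrow> int) \<Rightarrow> forest \<Rightarrow> bool" where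
  "heap_decomposition k n \<sigma> \<tau> F \<longleftrightarrow>
     heap_building \<sigma> \<tau> n F \<and> (\<forall>y \<in> dom F. card (children F y) \<le> k)"

definition optimal_heap_decomposition ::
    "nat \<Rightarrow> nat \<Rightarrow> (nat \<Rightarrow> nat) \<Rightarrow> (nat \<Rightarrow> int) \<Rightarrow> forest \<Rightarrow> bool" where
  "optimal_heap_decomposition k n \<sigma> \<tau> F \<longleftrightarrow>
     heap_decomposition k n \<sigma> \<tau> F \<and>
     (\<forall>G. heap_decomposition k n \<sigma> \<tau> G \<longrightarrow> forest_size F \<le> forest_size G)"

definition heapable :: "nat \<Rightarrow> nat \<Rightarrow> (nat \<Rightarrow> nat) \<Rightarrow> (nat \<Rightarrow> int) \<Rightarrow> bool" where
  "heapable k n \<sigma> \<tau> \<longleftrightarrow> (\<exists>F. heap_decomposition k n \<sigma> \<tau> F \<and> forest_size F = 1)"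

definition free_slots :: "nat \<Rightarrow> forest \<Rightarrow> nat \<Rightarrow> nat" where
  "free_slots k F y = k - card (children F y)"

text \<open>
  The values of the free slots of \<open>F\<close> that are compatible with \<open>\<sigma> i\<close>. Slots of the same value
  belong to the same node and are interchangeable, so the value determines the insertion.
\<close>

definition compatible_slot_values ::
    "nat \<Rightarrow> (nat \<Rightarrow> nat) \<Rightarrow> (nat \<Rightarrow> int) \<Rightarrow> forest \<Rightarrow> nat \<Rightarrow> nat set" where
  "compatible_slot_values k \<sigma> \<tau> F i =
     {\<sigma> j | j. j \<in> {1..<i} \<and> free_slots k F (\<sigma> j) > 0 \<and> \<sigma> j < \<sigma> i \<and> \<tau> j = - \<tau> i}"

text \<open>\<open>greedy k \<sigma> \<tau> i\<close> is the forest built by the algorithm after \<open>i\<close> insertions.\<close>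

fun greedy :: "nat \<Rightarrow> (nat \<Rightarrow> nat) \<Rightarrow> (nat \<Rightarrow> int) \<Rightarrow> nat \<Rightarrow> forest" where
  "greedy k \<sigma> \<tau> 0 = Map.empty"
| "greedy k \<sigma> \<tau> (Suc i) =
     (let F = greedy k \<sigma> \<tau> i; S = compatible_slot_values k \<sigma> \<tau> F (Suc i)
      in if S \<noteq> {} then F(\<sigma> (Suc i) \<mapsto> Some (Max S)) else F(\<sigma> (Suc i) \<mapsto> None))"

end

theory Submission
  imports Defs
begin

text \<open>
  Compare GREEDY with an arbitrary decomposition \<open>G\<close>, insertion by insertion. For a sign \<open>s\<close> let
  \<open>d s\<close> bound, over all thresholds \<open>x\<close>, the number by which the free slots of sign \<open>s\<close> and value
  below \<open>x\<close> in \<open>G\<close> exceed those in the greedy forest. The invariant is that such bounds exist with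
  \<open>d 1 + d (-1)\<close> at most the number of trees of \<open>G\<close> minus the number of greedy trees. Taking the
  largest compatible slot never increases the excess if \<open>G\<close> uses a slot too; if only \<open>G\<close> opens a
  tree, the excess grows by at most one; and if only GREEDY opens a tree, it had no compatible
  slot, so that the excess was positive and drops by one.
\<close>

text \<open>The bound \<open>i\<close> on the indices is kept separate from \<open>F\<close>, so
  that the two effects of an insertion can be treated apart: a parent losing a slot
  (\<open>i\<close> fixed) and the new node joining the sum (from \<open>i\<close> to
  \<open>Suc i\<close>).\<close>

definition slots_below ::
    "nat \<Rightarrow> (nat \<Rightarrow> nat) \<Rightarrow> (nat \<Rightarrow> int) \<Rightarrow> forest \<Rightarrow> nat \<Rightarrow> int \<Rightarrow> nat \<Rightarrow> nat" where
  "slots_below k \<sigma> \<tau> F i s x = (\<Sum>j | j \<in> {1..i} \<and> \<tau> j = s \<and> \<sigma> j < x. free_slots k F (\<sigma> j))"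

text \<open>A root has no incoming edge, so the only root reachable from a root is itself. Distinct
  roots therefore span distinct trees.\<close>

lemma forest_size_eq_card_roots: "forest_size F = card (roots F)"
proof -
  define tree where "tree = (\<lambda>r. {x. (r, x) \<in> {(y, z). z \<in> children F y}\<^sup>*})"
  have "inj_on tree (roots F)"
  proof (rule inj_onI)
    fix r r' assume r: "r \<in> roots F" "r' \<in> roots F" and "tree r = tree r'"
    then have "(r, r') \<in> {(y, z). z \<in> children F y}\<^sup>*"
      unfolding tree_def by blast
    then show "r = r'"
      by (cases rule: rtranclE) (use r in \<open>auto simp: roots_def children_def\<close>)
  qed
  moreover have "trees F = tree ` roots F"
    by (auto simp: trees_def tree_def)
  ultimately show ?thesis
    by (simp add: forest_size_def card_image)
qed

section \<open>Forests under insertion of a new element\<close>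

lemma dom_heap_building:
  assumes "heap_building \<sigma> \<tau> i F"
  shows "dom F = \<sigma> ` {1..i}"
  using assms by induction (simp_all add: atLeastAtMostSuc_conv del: fun_upd_apply)

lemma heap_building_parent:
  assumes "heap_building \<sigma> \<tau> i F" and "F x = Some (Some y)"
  shows "y \<in> \<sigma> ` {1..i}"
  using assms by (induction arbitrary: x y) (force split: if_splits)+

lemma children_subset_dom: "children F y \<subseteq> dom F"
  by (auto simp: children_def)

lemma children_upd_root:
  assumes "v \<notin> dom F"
  shows "children (F(v \<mapsto> None)) y = children F y"
  using assms by (auto simp: children_def)

lemma children_upd_leaf:
  assumes "v \<notin> dom F"
  shows "children (F(v \<mapsto> Some a)) y = (if y = a then insert v (children F y) else children F y)"
  using assms by (auto simp: children_def)

lemma roots_upd_root: "roots (F(v \<mapsto> None)) = insert v (roots F)"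
  by (auto simp: roots_def)

lemma roots_upd_leaf:
  assumes "v \<notin> dom F"
  shows "roots (F(v \<mapsto> Some a)) = roots F"
  using assms by (auto simp: roots_def)

section \<open>Slot counts at two thresholds\<close>

text \<open>The additional summands all vanish. Through this lemma the maximality of the greedy
  slot, or the lack of any compatible slot, enters the comparison.\<close>

lemma slots_below_eq_if_none_between:
  assumes "x \<le> y"
    and "\<And>j. j \<in> {1..i} \<Longrightarrow> \<tau> j = s \<Longrightarrow> x \<le> \<sigma> j \<Longrightarrow> \<sigma> j < y \<Longrightarrow> free_slots k F (\<sigma> j) = 0"
  shows "slots_below k \<sigma> \<tau> F i s y = slots_below k \<sigma> \<tau> F i s x"
  unfolding slots_below_def using assms
  by (intro sum.mono_neutral_right) (auto simp: not_less)

text \<open>The summand of \<open>j\<close> is positive and is counted for \<open>y\<close> but not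
  for \<open>x\<close>. It will be applied to the slot that the competing decomposition
  fills.\<close>

lemma slots_below_less:
  assumes "j \<in> {1..i}" and "x \<le> \<sigma> j" and "\<sigma> j < y" and "free_slots k F (\<sigma> j) > 0"
  shows "slots_below k \<sigma> \<tau> F i (\<tau> j) x < slots_below k \<sigma> \<tau> F i (\<tau> j) y"
  unfolding slots_below_def using assms
  by (intro sum_strict_mono2[where b = j]) auto

section \<open>Decompositions one insertion at a time\<close>

locale signed_sequence =
  fixes n :: nat and \<sigma> :: "nat \<Rightarrow> nat" and \<tau> :: "nat \<Rightarrow> int"
  assumes inj: "inj_on \<sigma> {1..n}" and sign: "i \<in> {1..n} \<Longrightarrow> \<tau> i \<in> {1, -1}"
begin

lemma fresh:
  assumes "heap_building \<sigma> \<tau> i F" and "Suc i \<le> n"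
  shows "\<sigma> (Suc i) \<notin> dom F"
proof
  assume "\<sigma> (Suc i) \<in> dom F"
  then obtain j where "j \<in> {1..i}" "\<sigma> j = \<sigma> (Suc i)"
    using dom_heap_building[OF assms(1)] by auto
  with inj_onD[OF inj, of j "Suc i"] assms(2) show False by auto
qed

lemma finite_children:
  assumes "heap_building \<sigma> \<tau> i F"
  shows "finite (children F y)"
  using finite_subset[OF children_subset_dom] dom_heap_building[OF assms] by simp

lemma finite_roots:
  assumes "heap_building \<sigma> \<tau> i F"
  shows "finite (roots F)"
  by (rule finite_subset[of _ "dom F"])
    (use dom_heap_building[OF assms] in \<open>auto simp: roots_def\<close>)

lemma children_fresh:
  assumes "heap_building \<sigma> \<tau> i F" and "Suc i \<le> n"
  shows "children F (\<sigma> (Suc i)) = {}"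
  using heap_building_parent[OF assms(1)] fresh[OF assms] dom_heap_building[OF assms(1)]
  unfolding children_def by blast

lemma card_roots_upd_root:
  assumes "heap_building \<sigma> \<tau> i F" and "Suc i \<le> n"
  shows "card (roots (F(\<sigma> (Suc i) \<mapsto> None))) = Suc (card (roots F))"
proof -
  have "\<sigma> (Suc i) \<notin> roots F"
    using fresh[OF assms] by (auto simp: roots_def)
  then show ?thesis
    by (simp add: roots_upd_root finite_roots[OF assms(1)])
qed

text \<open>A leaf is attached to an earlier index, so a leaf step has \<open>1 \<le> i\<close> and
  the root comes from the induction hypothesis.\<close>

lemma roots_nonempty:
  assumes "heap_building \<sigma> \<tau> i F" and "1 \<le> i" and "i \<le> n"
  shows "roots F \<noteq> {}"
  using assms
proof (induction)
  case (new_leaf i F j)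
  then show ?case
    using fresh[of i F] by (simp add: roots_upd_leaf del: fun_upd_apply)
qed (simp_all add: roots_upd_root del: fun_upd_apply)

lemma heap_decomposition_upd_root:
  assumes "heap_building \<sigma> \<tau> i F" and "Suc i \<le> n"
  shows "heap_decomposition k (Suc i) \<sigma> \<tau> (F(\<sigma> (Suc i) \<mapsto> None)) \<longleftrightarrow>
         heap_decomposition k i \<sigma> \<tau> F"
  using assms fresh[OF assms] children_fresh[OF assms]
  by (auto simp: heap_decomposition_def children_upd_root intro: heap_building.new_root)

text \<open>The degree bound is imposed on the finished forest only. The equivalence turns it into a
  condition at each insertion: just the parent gains a child, so the bound survives exactly if the
  parent had a free slot.\<close>

lemma heap_decomposition_upd_leaf:
  assumes hb: "heap_building \<sigma> \<tau> i F" and i: "Suc i \<le> n"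
    and j: "j \<in> {1..i}" and less: "\<sigma> j < \<sigma> (Suc i)" and opp: "\<tau> (Suc i) = - \<tau> j"
  shows "heap_decomposition k (Suc i) \<sigma> \<tau> (F(\<sigma> (Suc i) \<mapsto> Some (\<sigma> j))) \<longleftrightarrow>
         heap_decomposition k i \<sigma> \<tau> F \<and> free_slots k F (\<sigma> j) > 0"
proof -
  let ?v = "\<sigma> (Suc i)" and ?G = "F(\<sigma> (Suc i) \<mapsto> Some (\<sigma> j))"
  have v: "?v \<notin> dom F" by (rule fresh[OF hb i])
  have jF: "\<sigma> j \<in> dom F" using j dom_heap_building[OF hb] by auto
  have c: "card (children ?G y) = (if y = \<sigma> j then Suc (card (children F y)) else card (children F y))"
    for y
  proof -
    have "?v \<notin> children F (\<sigma> j)" using v children_subset_dom by blast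
    then show ?thesis by (simp add: children_upd_leaf[OF v] finite_children[OF hb])
  qed
  have cv: "card (children F ?v) = 0"
    by (simp add: children_fresh[OF hb i])
  have "(\<forall>y \<in> dom ?G. card (children ?G y) \<le> k) \<longleftrightarrow>
        (\<forall>y \<in> dom F. card (children F y) \<le> k) \<and> card (children F (\<sigma> j)) < k"
    unfolding c using jF v cv less by (auto split: if_splits)
  moreover have "heap_building \<sigma> \<tau> (Suc i) ?G"
    by (rule heap_building.new_leaf[OF hb j less opp])
  ultimately show ?thesis
    using hb by (auto simp: heap_decomposition_def free_slots_def)
qed

text \<open>Undoing the last insertion leaves a decomposition for the same \<open>k\<close>, which
  is what the induction over an arbitrary competitor needs.\<close>

lemma heap_decomposition_SucE:
  assumes "heap_decomposition k (Suc i) \<sigma> \<tau> G" and i: "Suc i \<le> n"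
  obtains (root) F where "heap_decomposition k i \<sigma> \<tau> F" "G = F(\<sigma> (Suc i) \<mapsto> None)"
  | (leaf) F j where "heap_decomposition k i \<sigma> \<tau> F" "j \<in> {1..i}" "free_slots k F (\<sigma> j) > 0"
      "\<sigma> j < \<sigma> (Suc i)" "\<tau> j = - \<tau> (Suc i)" "G = F(\<sigma> (Suc i) \<mapsto> Some (\<sigma> j))"
proof -
  from assms have "heap_building \<sigma> \<tau> (Suc i) G"
    by (simp add: heap_decomposition_def)
  then show thesis
  proof cases
    case (new_root F)
    then show thesis
      using root heap_decomposition_upd_root[OF _ i] assms(1) by blast
  next
    case (new_leaf F j)
    with assms(1) have "heap_decomposition k i \<sigma> \<tau> F \<and> free_slots k F (\<sigma> j) > 0"
      using heap_decomposition_upd_leaf[OF new_leaf(2) i new_leaf(3,4,5)] by simp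
    with new_leaf show thesis
      by (intro leaf[of F j]) auto
  qed
qed

section \<open>The greedy step\<close>

text \<open>Restates the choice of \<open>Max\<close> as the absence of free slots in an interval of
  values, the form that \<open>slots_below_eq_if_none_between\<close> takes as a premise.\<close>

lemma greedy_SucE:
  obtains (root) "greedy k \<sigma> \<tau> (Suc i) = (greedy k \<sigma> \<tau> i)(\<sigma> (Suc i) \<mapsto> None)"
      "\<And>j. j \<in> {1..i} \<Longrightarrow> \<tau> j = - \<tau> (Suc i) \<Longrightarrow> \<sigma> j < \<sigma> (Suc i)
        \<Longrightarrow> free_slots k (greedy k \<sigma> \<tau> i) (\<sigma> j) = 0"
  | (leaf) b where "greedy k \<sigma> \<tau> (Suc i) = (greedy k \<sigma> \<tau> i)(\<sigma> (Suc i) \<mapsto> Some (\<sigma> b))"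
      "b \<in> {1..i}" "free_slots k (greedy k \<sigma> \<tau> i) (\<sigma> b) > 0"
      "\<sigma> b < \<sigma> (Suc i)" "\<tau> b = - \<tau> (Suc i)"
      "\<And>j. j \<in> {1..i} \<Longrightarrow> \<tau> j = - \<tau> (Suc i) \<Longrightarrow> \<sigma> b < \<sigma> j \<Longrightarrow> \<sigma> j < \<sigma> (Suc i)
        \<Longrightarrow> free_slots k (greedy k \<sigma> \<tau> i) (\<sigma> j) = 0"
proof -
  define F where "F = greedy k \<sigma> \<tau> i"
  define S where "S = compatible_slot_values k \<sigma> \<tau> F (Suc i)"
  have S: "\<sigma> j \<in> S" if "j \<in> {1..i}" "\<tau> j = - \<tau> (Suc i)" "\<sigma> j < \<sigma> (Suc i)"
    "free_slots k F (\<sigma> j) > 0" for j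
    unfolding S_def compatible_slot_values_def using that by force
  have "finite S"
    unfolding S_def compatible_slot_values_def by (rule finite_subset[of _ "{..<\<sigma> (Suc i)}"]) auto
  show thesis
  proof (cases "S = {}")
    case True
    then have "greedy k \<sigma> \<tau> (Suc i) = F(\<sigma> (Suc i) \<mapsto> None)"
      by (simp add: F_def S_def Let_def)
    then show thesis
      using root S True unfolding F_def[symmetric] by fastforce
  next
    case False
    then have gr: "greedy k \<sigma> \<tau> (Suc i) = F(\<sigma> (Suc i) \<mapsto> Some (Max S))"
      by (simp add: F_def S_def Let_def)
    have "Max S \<in> S" using \<open>finite S\<close> False by (rule Max_in)
    then obtain b where b: "Max S = \<sigma> b" "b \<in> {1..i}" "free_slots k F (\<sigma> b) > 0"
      "\<sigma> b < \<sigma> (Suc i)" "\<tau> b = - \<tau> (Suc i)"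
      unfolding S_def compatible_slot_values_def by auto
    have max: "free_slots k F (\<sigma> j) = 0"
      if j: "j \<in> {1..i}" "\<tau> j = - \<tau> (Suc i)" "\<sigma> b < \<sigma> j" "\<sigma> j < \<sigma> (Suc i)" for j
    proof (rule ccontr)
      assume "free_slots k F (\<sigma> j) \<noteq> 0"
      then have "\<sigma> j \<in> S" using S j by simp
      then have "\<sigma> j \<le> \<sigma> b" using \<open>finite S\<close> Max_ge b(1) by metis
      with j show False by simp
    qed
    show thesis
      by (rule leaf[of b]) (use gr b max in \<open>simp_all add: F_def\<close>)
  qed
qed

lemma heap_decomposition_greedy:
  assumes "i \<le> n"
  shows "heap_decomposition k i \<sigma> \<tau> (greedy k \<sigma> \<tau> i)"
  using assms
proof (induction i)
  case 0
  then show ?case by (simp add: heap_decomposition_def heap_building.empty)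
next
  case (Suc i)
  then have hd: "heap_decomposition k i \<sigma> \<tau> (greedy k \<sigma> \<tau> i)" by simp
  then have hb: "heap_building \<sigma> \<tau> i (greedy k \<sigma> \<tau> i)" by (simp add: heap_decomposition_def)
  show ?case
  proof (cases rule: greedy_SucE[of k i])
    case root
    show ?thesis
      unfolding root(1) using heap_decomposition_upd_root[OF hb Suc.prems] hd by blast
  next
    case (leaf b)
    show ?thesis
      unfolding leaf(1)
      using heap_decomposition_upd_leaf[OF hb Suc.prems leaf(2,4)] leaf(3,5) hd by (simp del: fun_upd_apply)
  qed
qed

section \<open>Slot counts under insertion\<close>

lemma slots_below_Suc:
  assumes "children G (\<sigma> (Suc i)) = {}"
  shows "slots_below k \<sigma> \<tau> G (Suc i) s x =
         slots_below k \<sigma> \<tau> G i s x + (if \<tau> (Suc i) = s \<and> \<sigma> (Suc i) < x then k else 0)"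
proof -
  have "{j. j \<in> {1..Suc i} \<and> \<tau> j = s \<and> \<sigma> j < x} =
        (if \<tau> (Suc i) = s \<and> \<sigma> (Suc i) < x then insert (Suc i) else id)
          {j. j \<in> {1..i} \<and> \<tau> j = s \<and> \<sigma> j < x}"
    by (auto simp: le_Suc_eq)
  then show ?thesis
    using assms by (simp add: slots_below_def free_slots_def)
qed

lemma slots_below_upd_root:
  assumes hb: "heap_building \<sigma> \<tau> i F" and i: "Suc i \<le> n"
  shows "slots_below k \<sigma> \<tau> (F(\<sigma> (Suc i) \<mapsto> None)) (Suc i) s x =
         slots_below k \<sigma> \<tau> F i s x + (if \<tau> (Suc i) = s \<and> \<sigma> (Suc i) < x then k else 0)"
proof -
  have "free_slots k (F(\<sigma> (Suc i) \<mapsto> None)) y = free_slots k F y" for y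
    by (simp add: free_slots_def children_upd_root[OF fresh[OF hb i]])
  then have "slots_below k \<sigma> \<tau> (F(\<sigma> (Suc i) \<mapsto> None)) i s x = slots_below k \<sigma> \<tau> F i s x"
    by (simp add: slots_below_def)
  then show ?thesis
    by (simp add: slots_below_Suc children_upd_root[OF fresh[OF hb i]] children_fresh[OF hb i]
        del: fun_upd_apply)
qed

text \<open>One slot of the parent is consumed and the new node brings \<open>k\<close>. The
  consumed slot stands on the left-hand side to avoid truncated subtraction.\<close>

lemma slots_below_upd_leaf:
  assumes hb: "heap_building \<sigma> \<tau> i F" and i: "Suc i \<le> n"
    and j: "j \<in> {1..i}" and free: "free_slots k F (\<sigma> j) > 0"
    and less: "\<sigma> j < \<sigma> (Suc i)" and opp: "\<tau> j = - \<tau> (Suc i)"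
  shows "slots_below k \<sigma> \<tau> (F(\<sigma> (Suc i) \<mapsto> Some (\<sigma> j))) (Suc i) s x +
           (if \<tau> j = s \<and> \<sigma> j < x then 1 else 0) =
         slots_below k \<sigma> \<tau> F i s x + (if \<tau> (Suc i) = s \<and> \<sigma> (Suc i) < x then k else 0)"
proof -
  let ?G = "F(\<sigma> (Suc i) \<mapsto> Some (\<sigma> j))" and ?A = "{j. j \<in> {1..i} \<and> \<tau> j = s \<and> \<sigma> j < x}"
  have fr: "\<sigma> (Suc i) \<notin> dom F" by (rule fresh[OF hb i])
  \<comment> \<open>By injectivity no index other than \<open>j\<close> names the parent. At
    \<open>j\<close> the assumption \<open>free\<close> keeps the difference in
    \<open>free_slots\<close> from being truncated.\<close>
  have fs: "free_slots k F (\<sigma> l) = free_slots k ?G (\<sigma> l) + (if l = j then 1 else 0)"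
    if l: "l \<in> {1..i}" for l
  proof (cases "l = j")
    case True
    have "\<sigma> (Suc i) \<notin> children F (\<sigma> j)" using fr children_subset_dom by blast
    then show ?thesis
      using free True by (simp add: free_slots_def children_upd_leaf[OF fr] finite_children[OF hb])
  next
    case False
    then have "\<sigma> l \<noteq> \<sigma> j" using inj_onD[OF inj, of l j] l j i by auto
    with False show ?thesis by (simp add: free_slots_def children_upd_leaf[OF fr])
  qed
  have "slots_below k \<sigma> \<tau> F i s x =
        (\<Sum>l\<in>?A. free_slots k ?G (\<sigma> l) + (if l = j then 1 else 0))"
    unfolding slots_below_def by (rule sum.cong) (use fs in auto)
  also have "\<dots> = slots_below k \<sigma> \<tau> ?G i s x + (if \<tau> j = s \<and> \<sigma> j < x then 1 else 0)"
    using j by (simp add: slots_below_def sum.distrib)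
  finally have "slots_below k \<sigma> \<tau> F i s x =
    slots_below k \<sigma> \<tau> ?G i s x + (if \<tau> j = s \<and> \<sigma> j < x then 1 else 0)" .
  moreover have "children ?G (\<sigma> (Suc i)) = {}"
    using less children_fresh[OF hb i] by (simp add: children_upd_leaf[OF fr])
  ultimately show ?thesis
    by (simp add: slots_below_Suc del: fun_upd_apply)
qed

section \<open>Comparison with an arbitrary decomposition\<close>

text \<open>The new node adds the same \<open>k\<close> slots to both forests, so only the consumed
  slots matter. All thresholds are controlled at once because the next element may have any
  value.\<close>

lemma greedy_dominates:
  assumes "heap_decomposition k i \<sigma> \<tau> G" and "i \<le> n"
  shows "\<exists>d. card (roots (greedy k \<sigma> \<tau> i)) + (d 1 + d (-1)) \<le> card (roots G) \<and>
    (\<forall>s x. slots_below k \<sigma> \<tau> G i s x \<le> slots_below k \<sigma> \<tau> (greedy k \<sigma> \<tau> i) i s x + d s)"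
  using assms
proof (induction i arbitrary: G)
  case 0
  then have "G = Map.empty"
    by (auto simp: heap_decomposition_def elim: heap_building.cases)
  then show ?case
    by (intro exI[of _ "\<lambda>_. 0"]) simp
next
  case (Suc i)
  define F where "F = greedy k \<sigma> \<tau> i"
  define v where "v = \<sigma> (Suc i)"
  \<comment> \<open>The sign of the possible parents; \<open>d t\<close> is the only bound that the
    step may change.\<close>
  define t where "t = - \<tau> (Suc i)"
  have i: "Suc i \<le> n" by fact
  have t: "t \<in> {1, -1}" using sign[of "Suc i"] i by (auto simp: t_def)
  have hbF: "heap_building \<sigma> \<tau> i F"
    using heap_decomposition_greedy i unfolding F_def heap_decomposition_def by simp
  note simps = slots_below_upd_root[OF _ i] card_roots_upd_root[OF _ i]
    roots_upd_leaf[OF fresh[OF _ i]]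
  have sum_upd: "(d(t := c)) 1 + (d(t := c)) (-1) + d t = d 1 + d (-1) + c"
    for c and d :: "int \<Rightarrow> nat"
    using t by auto
  from Suc.prems show ?case
  proof (cases rule: heap_decomposition_SucE)
    case (root H)
    have hbH: "heap_building \<sigma> \<tau> i H" using root(1) by (simp add: heap_decomposition_def)
    obtain d where d: "card (roots F) + (d 1 + d (-1)) \<le> card (roots H)"
      "\<And>s x. slots_below k \<sigma> \<tau> H i s x \<le> slots_below k \<sigma> \<tau> F i s x + d s"
      using Suc.IH[OF root(1)] i unfolding F_def by auto
    show ?thesis
    proof (cases rule: greedy_SucE[of k i])
      case groot: root
      show ?thesis
        unfolding groot(1) root(2) F_def[symmetric]
        by (rule exI[of _ d]) (use d hbF hbH in \<open>simp add: simps del: fun_upd_apply\<close>)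
    next
      case (leaf b)
      note F' = slots_below_upd_leaf[OF hbF i leaf(2) leaf(3)[folded F_def] leaf(4,5)]
      show ?thesis
        unfolding leaf(1) root(2) F_def[symmetric]
      \<comment> \<open>The tree opened by the competitor alone pays for the increase of
        \<open>d t\<close>, which covers the slot that GREEDY loses at thresholds above
        \<open>\<sigma> b\<close>.\<close>
      proof (intro exI[of _ "d(t := Suc (d t))"] conjI allI)
        show "card (roots (F(\<sigma> (Suc i) \<mapsto> Some (\<sigma> b)))) +
            ((d(t := Suc (d t))) 1 + (d(t := Suc (d t))) (-1))
          \<le> card (roots (H(\<sigma> (Suc i) \<mapsto> None)))"
          using d(1) sum_upd[of d "Suc (d t)"] hbF hbH by (simp add: simps del: fun_upd_apply)
        fix s x
        show "slots_below k \<sigma> \<tau> (H(\<sigma> (Suc i) \<mapsto> None)) (Suc i) s x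
          \<le> slots_below k \<sigma> \<tau> (F(\<sigma> (Suc i) \<mapsto> Some (\<sigma> b))) (Suc i) s x + (d(t := Suc (d t))) s"
          using d(2)[of s x] F'[of s x] leaf(5)
          by (auto simp: slots_below_upd_root[OF hbH i] t_def split: if_splits)
      qed
    qed
  next
    case (leaf H a)
    note la = leaf
    have hbH: "heap_building \<sigma> \<tau> i H" using la(1) by (simp add: heap_decomposition_def)
    obtain d where d: "card (roots F) + (d 1 + d (-1)) \<le> card (roots H)"
      "\<And>s x. slots_below k \<sigma> \<tau> H i s x \<le> slots_below k \<sigma> \<tau> F i s x + d s"
      using Suc.IH[OF la(1)] i unfolding F_def by auto
    note H' = slots_below_upd_leaf[OF hbH i la(2-5)]
    \<comment> \<open>At thresholds up to \<open>\<sigma> a\<close> the competitor's count does not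
      drop when the slot of \<open>a\<close> is filled. The missing unit is gained there by
      comparing with the threshold \<open>v\<close>, below which that slot is counted.\<close>
    have H_less: "slots_below k \<sigma> \<tau> H i t x < slots_below k \<sigma> \<tau> H i t v" if "x \<le> \<sigma> a" for x
      using slots_below_less[of a i x \<sigma> v k H \<tau>] that la(2-5) by (simp add: t_def v_def)
    show ?thesis
    proof (cases rule: greedy_SucE[of k i])
      case root
      have F_const: "slots_below k \<sigma> \<tau> F i t x = slots_below k \<sigma> \<tau> F i t v" if "x \<le> v" for x
        using slots_below_eq_if_none_between[of x v i \<tau> t \<sigma> k F] that root(2)
        by (simp add: F_def t_def v_def)
      \<comment> \<open>The count is constant up to \<open>v\<close>, and at threshold 0 it is an
        empty sum.\<close>
      have F_0: "slots_below k \<sigma> \<tau> F i t x = 0" if "x \<le> v" for x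
        using F_const[OF that] F_const[of 0] by (simp add: slots_below_def)
      \<comment> \<open>The competitor has a compatible slot and GREEDY has none, so
        \<open>d t - 1\<close> below is a genuine decrement.\<close>
      have dt: "d t > 0"
        using d(2)[of t v] H_less[of 0] F_0[of v] by simp
      show ?thesis
        unfolding root(1) la(6) F_def[symmetric]
      proof (intro exI[of _ "d(t := d t - 1)"] conjI allI)
        show "card (roots (F(\<sigma> (Suc i) \<mapsto> None))) +
            ((d(t := d t - 1)) 1 + (d(t := d t - 1)) (-1))
          \<le> card (roots (H(\<sigma> (Suc i) \<mapsto> Some (\<sigma> a))))"
          using d(1) dt sum_upd[of d "d t - 1"] hbF hbH by (simp add: simps del: fun_upd_apply)
        fix s x
        \<comment> \<open>Above \<open>\<sigma> a\<close> the competitor itself loses a slot; up to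
          \<open>\<sigma> a\<close> its count is smaller than the one at \<open>v\<close>, which is
          at most \<open>d t\<close>.\<close>
        have "slots_below k \<sigma> \<tau> H i t x \<le> d t - 1" if "x \<le> \<sigma> a"
          using H_less[OF that] d(2)[of t v] F_0[of v] by simp
        then show "slots_below k \<sigma> \<tau> (H(\<sigma> (Suc i) \<mapsto> Some (\<sigma> a))) (Suc i) s x
          \<le> slots_below k \<sigma> \<tau> (F(\<sigma> (Suc i) \<mapsto> None)) (Suc i) s x + (d(t := d t - 1)) s"
          using d(2)[of s x] H'[of s x] la(4,5) dt
          by (cases "x \<le> \<sigma> a"; cases "s = t")
            (auto simp: slots_below_upd_root[OF hbF i] t_def split: if_splits)
      qed
    next
      case (leaf b)
      note F' = slots_below_upd_leaf[OF hbF i leaf(2) leaf(3)[folded F_def] leaf(4,5)]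
      have F_const: "slots_below k \<sigma> \<tau> F i t v = slots_below k \<sigma> \<tau> F i t x"
        if "\<sigma> b < x" "x \<le> v" for x
        using slots_below_eq_if_none_between[of x v i \<tau> t \<sigma> k F] that leaf(6)
        by (simp add: F_def t_def v_def)
      show ?thesis
        unfolding leaf(1) la(6) F_def[symmetric]
      proof (intro exI[of _ d] conjI allI)
        show "card (roots (F(\<sigma> (Suc i) \<mapsto> Some (\<sigma> b)))) + (d 1 + d (-1))
          \<le> card (roots (H(\<sigma> (Suc i) \<mapsto> Some (\<sigma> a))))"
          using d(1) hbF hbH by (simp add: simps del: fun_upd_apply)
        fix s x
        \<comment> \<open>The only critical thresholds: GREEDY loses a slot here and the competitor
          does not. The old bound is strict, since passing from \<open>x\<close> to \<open>v\<close>
          leaves the greedy count unchanged but raises the other one.\<close>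
        have "slots_below k \<sigma> \<tau> H i t x < slots_below k \<sigma> \<tau> F i t x + d t" if "\<sigma> b < x" "x \<le> \<sigma> a"
          using H_less[OF that(2)] d(2)[of t v] F_const[OF that(1)] that(2) la(4) by (simp add: v_def)
        then show "slots_below k \<sigma> \<tau> (H(\<sigma> (Suc i) \<mapsto> Some (\<sigma> a))) (Suc i) s x
          \<le> slots_below k \<sigma> \<tau> (F(\<sigma> (Suc i) \<mapsto> Some (\<sigma> b))) (Suc i) s x + d s"
          using d(2)[of s x] H'[of s x] F'[of s x] la(5) leaf(5)
          by (cases "s = t"; cases "\<sigma> b < x"; cases "x \<le> \<sigma> a") (auto simp: t_def split: if_splits)
      qed
    qed
  qed
qed

section \<open>Optimality and heapability\<close>

lemma optimal_heap_decomposition_greedy: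
  "optimal_heap_decomposition k n \<sigma> \<tau> (greedy k \<sigma> \<tau> n)"
  unfolding optimal_heap_decomposition_def forest_size_eq_card_roots
  using heap_decomposition_greedy[of n k] greedy_dominates[of k n] by fastforce

lemma forest_size_pos:
  assumes "heap_decomposition k n \<sigma> \<tau> F" and "1 \<le> n"
  shows "forest_size F > 0"
  using assms roots_nonempty[of n F] finite_roots[of n F]
  by (auto simp: heap_decomposition_def forest_size_eq_card_roots card_gt_0_iff)

end

theorem theorem18:
  fixes k n :: nat and \<sigma> :: "nat \<Rightarrow> nat" and \<tau> :: "nat \<Rightarrow> int"
  assumes "k \<ge> 1" and "signed_permutation n \<sigma> \<tau>"
  shows "optimal_heap_decomposition k n \<sigma> \<tau> (greedy k \<sigma> \<tau> n) \<and>
         (heapable k n \<sigma> \<tau> \<longleftrightarrow> forest_size (greedy k \<sigma> \<tau> n) = 1)"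
proof -
  have n: "1 \<le> n" and perm: "\<sigma> permutes {1..n}" and sign: "\<tau> \<in> {1..n} \<rightarrow> {1, -1}"
    using assms(2) by (auto simp: signed_permutation_def)
  interpret signed_sequence n \<sigma> \<tau>
    using permutes_inj_on[OF perm] sign by unfold_locales auto
  have opt: "optimal_heap_decomposition k n \<sigma> \<tau> (greedy k \<sigma> \<tau> n)"
    by (rule optimal_heap_decomposition_greedy)
  \<comment> \<open>Optimality bounds the greedy size by 1 as soon as some one-tree decomposition
    exists; positivity then makes it equal to 1.\<close>
  have "forest_size (greedy k \<sigma> \<tau> n) > 0"
    using heap_decomposition_greedy n by (intro forest_size_pos) auto
  then have "heapable k n \<sigma> \<tau> \<longleftrightarrow> forest_size (greedy k \<sigma> \<tau> n) = 1"
    using opt unfolding optimal_heap_decomposition_def heapable_def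
    by (metis One_nat_def Suc_leI le_antisym)
  with opt show ?thesis ..
qed

end
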